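(* Let $\mathcal{A}\in\mathbb{R}^{n\times n\times n}$ be an antisymmetric tensor. The problem of finding vectors $x,y,z\in\mathbb{R}^n$ that minimize $\|\mathcal{A}-\mathcal{A}_6(x,y,z)\|^2$ is equivalent to the problem of finding the best structure-preserving (antisymmetric) multilinear rank-$3$ approximation of $\mathcal{A}$, that is, to the maximization of $\|\mathcal{A}\times_1V^T\times_2V^T\times_3V^T\|$ over matrices $V\in\mathbb{R}^{n\times3}$ with orthonormal columns. Consequently, it is equivalent to the problem of finding the best unstructured rank-$1$ approximation of $\mathcal{A}$.
   Context: A tensor $\mathcal{A}=(a_{ijk})\in\mathbb{R}^{n\times n\times n}$ is antisymmetric if $a_{ijk}=a_{jki}=a_{kij}=-a_{ikj}=-a_{jik}=-a_{kji}$ for all $1\le i,j,k\le n$. The outer product of vectors is $(u\circ v\circ w)_{ijk}=u_iv_jw_k$. For $x,y,z\in\mathbb{R}^n$, $$\mathcal{A}_6(x,y,z)=\tfrac16\left(x\circ y\circ z+y\circ z\circ x+z\circ x\circ y-x\circ z\circ y-y\circ x\circ z-z\circ y\circ x\right).$$ The norm is the Frobenius norm $\|\mathcal{A}\|=\big(\sum_{i,j,k}a_{ijk}^2\big)^{1/2}$. The mode-$m$ product $\mathcal{A}\times_mM$ contracts the $m$-th index of $\mathcal{A}$ with the column index of the matrix $M$; in particular, for $V\in\mathbb{R}^{n\times3}$, $(\mathcal{A}\times_1V^T\times_2V^T\times_3V^T)_{pqr}=\sum_{i,j,k}a_{ijk}V_{ip}V_{jq}V_{kr}$ is a $3\times3\times3$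 tensor. The best structure-preserving multilinear rank-$3$ approximation problem is the problem of approximating $\mathcal{A}$ in norm by an antisymmetric tensor of the form $\mathcal{S}\times_1V\times_2V\times_3V$ with $\mathcal{S}\in\mathbb{R}^{3\times3\times3}$ antisymmetric and $V\in\mathbb{R}^{n\times3}$ having orthonormal columns; it corresponds to the maximization problem named in the claim. The best unstructured rank-$1$ approximation problem is the problem of minimizing $\|\mathcal{A}-u\circ v\circ w\|$ over all $u,v,w\in\mathbb{R}^n$, with no antisymmetry imposed on the approximation. *)

theory Defs
  imports "HOL-Analysis.Analysis"
begin

text \<open>
  A third-order tensor is an element of \<^typ>\<open>real^'c^'b^'a\<close> with entries \<open>A $ i $ j $ k\<close>;
  an \<open>m \<times> n\<close> matrix is an element of \<^typ>\<open>real^'n^'m\<close>.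
  The norm of the type is the Frobenius norm:
\<close>

lemma norm_tensor_eq_frobenius:
  fixes A :: "real^'c::finite^'b::finite^'a::finite"
  shows "norm A = sqrt (\<Sum>i\<in>UNIV. \<Sum>j\<in>UNIV. \<Sum>k\<in>UNIV. (A $ i $ j $ k)\<^sup>2)"
  by (simp add: norm_vec_def L2_set_def sum_nonneg)

definition antisymmetric :: "real^'n^'n^'n \<Rightarrow> bool" where
  "antisymmetric A \<longleftrightarrow> (\<forall>i j k.
     A $ i $ j $ k = A $ j $ k $ i \<and>
     A $ i $ j $ k = A $ k $ i $ j \<and>
     A $ i $ j $ k = - A $ i $ k $ j \<and>
     A $ i $ j $ k = - A $ j $ i $ k \<and>
     A $ i $ j $ k = - A $ k $ j $ i)"

definition outer :: "real^'a \<Rightarrow> real^'b \<Rightarrow> real^'c \<Rightarrow> real^'c^'b^'a" where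
  "outer u v w = (\<chi> i j k. u $ i * v $ j * w $ k)"

definition A6 :: "real^'n \<Rightarrow> real^'n \<Rightarrow> real^'n \<Rightarrow> real^'n^'n^'n" where
  "A6 x y z = (1 / 6) *\<^sub>R
     (outer x y z + outer y z x + outer z x y - outer x z y - outer y x z - outer z y x)"

definition mode1 :: "real^'c^'b^'a \<Rightarrow> real^'a^'p \<Rightarrow> real^'c^'b^'p" (infixl "\<times>\<^sub>1" 70) where
  "A \<times>\<^sub>1 M = (\<chi> p j k. \<Sum>i\<in>UNIV. A $ i $ j $ k * M $ p $ i)"

definition mode2 :: "real^'c^'b^'a \<Rightarrow> real^'b^'p \<Rightarrow> real^'c^'p^'a" (infixl "\<times>\<^sub>2" 70) where
  "A \<times>\<^sub>2 M = (\<chi> i p k. \<Sum>j\<in>UNIV. A $ i $ j $ k * M $ p $ j)"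

definition mode3 :: "real^'c^'b^'a \<Rightarrow> real^'c^'p \<Rightarrow> real^'p^'b^'a" (infixl "\<times>\<^sub>3" 70) where
  "A \<times>\<^sub>3 M = (\<chi> i j p. \<Sum>k\<in>UNIV. A $ i $ j $ k * M $ p $ k)"

definition multi_prod :: "real^'a^'a^'a \<Rightarrow> real^'a^'p \<Rightarrow> real^'p^'p^'p" where
  "multi_prod A M = A \<times>\<^sub>1 M \<times>\<^sub>2 M \<times>\<^sub>3 M"

definition orthonormal_columns :: "real^'k^'n \<Rightarrow> bool" where
  "orthonormal_columns V \<longleftrightarrow> transpose V ** V = mat 1"

definition best_A6 ::
    "real^'n^'n^'n \<Rightarrow> real^'n \<Rightarrow> real^'n \<Rightarrow> real^'n \<Rightarrow> bool" where
  "best_A6 A x y z \<longleftrightarrow>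
     is_arg_min (\<lambda>(x, y, z). (norm (A - A6 x y z))\<^sup>2) (\<lambda>_. True) (x, y, z)"

definition best_structured :: "real^'n^'n^'n \<Rightarrow> real^3^3^3 \<Rightarrow> real^3^'n \<Rightarrow> bool" where
  "best_structured A S V \<longleftrightarrow>
     is_arg_min (\<lambda>(S, V). norm (A - multi_prod S V))
       (\<lambda>(S, V). antisymmetric S \<and> orthonormal_columns V) (S, V)"

definition max_compression :: "real^'n^'n^'n \<Rightarrow> real^3^'n \<Rightarrow> bool" where
  "max_compression A V \<longleftrightarrow>
     is_arg_max (\<lambda>V. norm (multi_prod A (transpose V))) orthonormal_columns V"

definition best_rank1 ::
    "real^'n^'n^'n \<Rightarrow> real^'n \<Rightarrow> real^'n \<Rightarrow> real^'n \<Rightarrow> bool" where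
  "best_rank1 A u v w \<longleftrightarrow>
     is_arg_min (\<lambda>(u, v, w). norm (A - outer u v w)) (\<lambda>_. True) (u, v, w)"

definition pairwise_orthogonal3 :: "real^'n \<Rightarrow> real^'n \<Rightarrow> real^'n \<Rightarrow> bool" where
  "pairwise_orthogonal3 u v w \<longleftrightarrow> orthogonal u v \<and> orthogonal u w \<and> orthogonal v w"

lemma multi_prod_transpose_nth:
  fixes A :: "real^'n^'n^'n" and V :: "real^'p^'n"
  shows "multi_prod A (transpose V) $ p $ q $ r =
    (\<Sum>i\<in>UNIV. \<Sum>j\<in>UNIV. \<Sum>k\<in>UNIV. A $ i $ j $ k * V $ i $ p * V $ j $ q * V $ k $ r)"
proof -
  have "multi_prod A (transpose V) $ p $ q $ r =
    (\<Sum>k\<in>UNIV. \<Sum>j\<in>UNIV. \<Sum>i\<in>UNIV. A $ i $ j $ k * V $ i $ p * V $ j $ q * V $ k $ r)"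
    by (simp add: multi_prod_def mode1_def mode2_def mode3_def transpose_def sum_distrib_right)
  also have "\<dots> = (\<Sum>k\<in>UNIV. \<Sum>i\<in>UNIV. \<Sum>j\<in>UNIV. A $ i $ j $ k * V $ i $ p * V $ j $ q * V $ k $ r)"
    by (intro sum.cong refl sum.swap)
  also have "\<dots> = (\<Sum>i\<in>UNIV. \<Sum>k\<in>UNIV. \<Sum>j\<in>UNIV. A $ i $ j $ k * V $ i $ p * V $ j $ q * V $ k $ r)"
    by (rule sum.swap)
  also have "\<dots> = (\<Sum>i\<in>UNIV. \<Sum>j\<in>UNIV. \<Sum>k\<in>UNIV. A $ i $ j $ k * V $ i $ p * V $ j $ q * V $ k $ r)"
    by (intro sum.cong refl sum.swap)
  finally show ?thesis .
qed

end

(*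
  Gram-Schmidt without normalization does not change A6 x y z, so every A6 x y z is 6 A6 u v w
  with u, v, w pairwise orthogonal. Against an antisymmetric A, the tensors A6 u v w and
  u o v o w have the same inner product, while 6 |A6 u v w|^2 <= |u o v o w|^2 with equality
  for orthogonal triples. Hence
    |A - 6 A6 u v w|^2 - |A|^2 <= 6 (|A - u o v o w|^2 - |A|^2),
  with the same equality case, and the A6 problem and the rank-1 problem have corresponding
  minimizers.

  An antisymmetric 3x3x3 tensor is determined by one entry, so for n >= 3 the tensors A6 x y z
  are exactly the tensors S x1 V x2 V x3 V. For V with orthonormal columns and
  P = A x1 V^T x2 V^T x3 V^T,
    |A - S x1 V x2 V x3 V|^2 = |A|^2 - |P|^2 + |S - P|^2,
  so that the best S is P and minimizing over V means maximizing |P|.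
*)
theory Submission
  imports Defs
begin

section \<open>Inner products of antisymmetric tensors with outer products\<close>

lemma inner_outer_eq_sum:
  "A \<bullet> outer u v w = (\<Sum>i\<in>UNIV. \<Sum>j\<in>UNIV. \<Sum>k\<in>UNIV. A $ i $ j $ k * (u $ i * v $ j * w $ k))"
  by (simp add: inner_vec_def outer_def)

lemma inner_outer_outer:
  "outer a b c \<bullet> outer u v w = (a \<bullet> u) * (b \<bullet> v) * (c \<bullet> w)"
  by (simp add: inner_outer_eq_sum outer_def inner_vec_def sum_product sum_distrib_left
      sum_distrib_right ac_simps)

text \<open>Renaming the summation indices moves the exchange of the vectors onto the entries of
  \<open>A\<close>, where antisymmetry supplies the sign.\<close>

lemma inner_outer_swap12:
  assumes "antisymmetric A"
  shows "A \<bullet> outer v u w = - (A \<bullet> outer u v w)"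
proof -
  have *: "A $ i $ j $ k = - A $ j $ i $ k" for i j k
    using assms unfolding antisymmetric_def by blast
  have "A \<bullet> outer v u w = (\<Sum>j\<in>UNIV. \<Sum>i\<in>UNIV. \<Sum>k\<in>UNIV. A $ i $ j $ k * (v $ i * u $ j * w $ k))"
    unfolding inner_outer_eq_sum by (rule sum.swap)
  also have "\<dots> = (\<Sum>j\<in>UNIV. \<Sum>i\<in>UNIV. \<Sum>k\<in>UNIV. - (A $ j $ i $ k * (u $ j * v $ i * w $ k)))"
    by (intro sum.cong refl, subst *) (simp add: ac_simps)
  finally show ?thesis
    by (simp add: inner_outer_eq_sum sum_negf)
qed

lemma inner_outer_swap23:
  assumes "antisymmetric A"
  shows "A \<bullet> outer u w v = - (A \<bullet> outer u v w)"
proof -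
  have *: "A $ i $ j $ k = - A $ i $ k $ j" for i j k
    using assms unfolding antisymmetric_def by blast
  have "A \<bullet> outer u w v = (\<Sum>i\<in>UNIV. \<Sum>k\<in>UNIV. \<Sum>j\<in>UNIV. A $ i $ j $ k * (u $ i * w $ j * v $ k))"
    unfolding inner_outer_eq_sum by (intro sum.cong refl sum.swap)
  also have "\<dots> = (\<Sum>i\<in>UNIV. \<Sum>k\<in>UNIV. \<Sum>j\<in>UNIV. - (A $ i $ k $ j * (u $ i * v $ k * w $ j)))"
    by (intro sum.cong refl, subst *) (simp add: ac_simps)
  finally show ?thesis
    by (simp add: inner_outer_eq_sum sum_negf)
qed

text \<open>Against \<open>A\<close>, permuting the vectors yields exactly the sign that
  \<open>A6\<close> attaches to the permutation. The six terms agree, and 1/6 averages them.\<close>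

lemma inner_A6:
  assumes "antisymmetric A"
  shows "A \<bullet> A6 x y z = A \<bullet> outer x y z"
proof -
  note swap = inner_outer_swap12[OF assms] inner_outer_swap23[OF assms]
  have "A \<bullet> outer x z y = - (A \<bullet> outer x y z)" "A \<bullet> outer y x z = - (A \<bullet> outer x y z)"
    "A \<bullet> outer y z x = A \<bullet> outer x y z" "A \<bullet> outer z x y = A \<bullet> outer x y z"
    "A \<bullet> outer z y x = - (A \<bullet> outer x y z)"
    using swap(2)[where u = x and v = y and w = z] swap(1)[where u = x and v = y and w = z]
      swap(2)[where u = y and v = x and w = z] swap(1)[where u = x and v = z and w = y]
      swap(1)[where u = y and v = z and w = x]
    by simp_all
  then show ?thesis
    by (simp add: A6_def inner_simps)
qed

section \<open>The alternating product \<open>A6\<close> and Gram-Schmidt\<close>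

lemma antisymmetric_A6: "antisymmetric (A6 x y z)"
  unfolding antisymmetric_def A6_def outer_def by (auto simp: algebra_simps)

lemma A6_scaleR: "A6 (c *\<^sub>R x) y z = c *\<^sub>R A6 x y z"
  by (simp add: vec_eq_iff A6_def outer_def algebra_simps)

lemma A6_add_multiple2: "A6 x (y + k *\<^sub>R x) z = A6 x y z"
  by (simp add: vec_eq_iff A6_def outer_def algebra_simps)

lemma A6_add_multiples3: "A6 x y (z + l *\<^sub>R x + m *\<^sub>R y) = A6 x y z"
  by (simp add: vec_eq_iff A6_def outer_def algebra_simps)

lemma norm_outer_squared: "(norm (outer u v w))\<^sup>2 = (norm u)\<^sup>2 * (norm v)\<^sup>2 * (norm w)\<^sup>2"
  by (simp add: power2_norm_eq_inner inner_outer_outer)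

text \<open>By \<open>inner_A6\<close> applied to \<open>A6 x y z\<close> itself, only its inner
  product with \<open>outer x y z\<close> is left. Orthogonality kills every permutation but the
  identity, which carries the factor 1/6.\<close>

lemma norm_A6_orthogonal:
  assumes "pairwise_orthogonal3 x y z"
  shows "6 * (norm (A6 x y z))\<^sup>2 = (norm (outer x y z))\<^sup>2"
  using assms unfolding power2_norm_eq_inner inner_A6[OF antisymmetric_A6]
  by (simp add: A6_def inner_simps inner_outer_outer pairwise_orthogonal3_def orthogonal_def)

lemma orthogonalize_step:
  fixes x y :: "'a::real_inner"
  obtains k y' where "y = y' + k *\<^sub>R x" "orthogonal x y'"
proof -
  \<comment> \<open>For \<open>x = 0\<close> the quotient is 0 by convention, so
    \<open>y' = y\<close>.\<close>
  have "orthogonal x (y - (x \<bullet> y / (x \<bullet> x)) *\<^sub>R x)"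
    by (simp add: orthogonal_def inner_diff_right)
  then show thesis
    by (intro that[of "y - (x \<bullet> y / (x \<bullet> x)) *\<^sub>R x" "x \<bullet> y / (x \<bullet> x)"]) auto
qed

text \<open>By Pythagoras, Gram-Schmidt shortens a vector unless it leaves it unchanged. The norm
  clauses record this for the inequality between the norms and for its equality case.\<close>

lemma A6_orthogonalize:
  obtains y' z' where "A6 x y' z' = A6 x y z" "pairwise_orthogonal3 x y' z'"
    "norm y' \<le> norm y" "norm y' = norm y \<Longrightarrow> y' = y"
    "norm z' \<le> norm z" "norm z' = norm z \<Longrightarrow> z' = z"
proof -
  obtain k y' where y: "y = y' + k *\<^sub>R x" and xy: "orthogonal x y'"
    using orthogonalize_step .
  obtain l z0 where z0: "z = z0 + l *\<^sub>R x" and xz0: "orthogonal x z0"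
    using orthogonalize_step .
  obtain m z' where z': "z0 = z' + m *\<^sub>R y'" and yz: "orthogonal y' z'"
    using orthogonalize_step .
  \<comment> \<open>Removing the \<open>y'\<close> component does not spoil orthogonality to
    \<open>x\<close>, because \<open>y'\<close> is already orthogonal to \<open>x\<close>.\<close>
  have xz: "orthogonal x z'"
    using xz0 xy unfolding z' by (simp add: orthogonal_def inner_add_right)
  have z: "z = z' + m *\<^sub>R y' + l *\<^sub>R x"
    using z0 z' by simp
  have ny: "(norm y)\<^sup>2 = (norm y')\<^sup>2 + (norm (k *\<^sub>R x))\<^sup>2"
    unfolding y using xy by (intro norm_add_Pythagorean) (simp add: orthogonal_def inner_commute)
  have nz: "(norm z)\<^sup>2 = (norm z')\<^sup>2 + (norm (m *\<^sub>R y' + l *\<^sub>R x))\<^sup>2"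
    unfolding z add.assoc using xz yz
    by (intro norm_add_Pythagorean) (simp add: orthogonal_def inner_add_right inner_commute)
  show thesis
  proof
    show "A6 x y' z' = A6 x y z"
      unfolding y z A6_add_multiple2
      using A6_add_multiples3[of x y' z' l m] by (simp add: add.commute add.left_commute)
    show "pairwise_orthogonal3 x y' z'"
      using xy xz yz by (simp add: pairwise_orthogonal3_def)
    show "norm y' \<le> norm y" "norm z' \<le> norm z"
      by (rule power2_le_imp_le; simp add: ny nz)+
    show "y' = y" if "norm y' = norm y"
      using ny that unfolding y by simp
    show "z' = z" if "norm z' = norm z"
      using nz that unfolding z by simp
  qed
qed

lemma outer_eq_0_iff: "outer u v w = 0 \<longleftrightarrow> u = 0 \<or> v = 0 \<or> w = 0"
proof -
  have "outer u v w = 0 \<longleftrightarrow> (norm (outer u v w))\<^sup>2 = 0"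
    by simp
  also have "\<dots> \<longleftrightarrow> u = 0 \<or> v = 0 \<or> w = 0"
    unfolding norm_outer_squared by simp
  finally show ?thesis .
qed

text \<open>Gram-Schmidt keeps \<open>A6\<close> and can only shrink the norms whose product is the
  norm of the outer product; this reduces the bound to the orthogonal case.\<close>

lemma norm_A6_le_outer: "6 * (norm (A6 u v w))\<^sup>2 \<le> (norm (outer u v w))\<^sup>2"
proof -
  obtain v' w' where *: "A6 u v' w' = A6 u v w" "pairwise_orthogonal3 u v' w'"
    "norm v' \<le> norm v" "norm w' \<le> norm w"
    using A6_orthogonalize .
  have "(norm (outer u v' w'))\<^sup>2 \<le> (norm (outer u v w))\<^sup>2"
    unfolding norm_outer_squared using *(3,4) by (intro mult_mono power_mono) auto
  then show ?thesis
    using norm_A6_orthogonal[OF *(2)] by (simp add: *(1))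
qed

text \<open>Under equality, Gram-Schmidt preserves the product of the norms. If that product is
  nonzero, no factor can make up for a loss in another, so \<open>v\<close> and \<open>w\<close>
  were left unchanged. A zero outer product is represented by three zero vectors instead, whence a
  conclusion about the tensor and not about \<open>u\<close>, \<open>v\<close>,
  \<open>w\<close>.\<close>

lemma outer_orthogonal_if_norm_eq:
  assumes "6 * (norm (A6 u v w))\<^sup>2 = (norm (outer u v w))\<^sup>2"
  obtains u' v' w' where "outer u v w = outer u' v' w'" "pairwise_orthogonal3 u' v' w'"
proof (cases "outer u v w = 0")
  case True
  then show thesis
    using that[of 0 0 0] outer_eq_0_iff[of 0 0 0]
    by (simp add: pairwise_orthogonal3_def orthogonal_def)
next
  case False
  obtain v' w' where *: "A6 u v' w' = A6 u v w" "pairwise_orthogonal3 u v' w'"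
    and v: "norm v' \<le> norm v" "norm v' = norm v \<Longrightarrow> v' = v"
    and w: "norm w' \<le> norm w" "norm w' = norm w \<Longrightarrow> w' = w"
    using A6_orthogonalize[of u v w] by blast
  have pos: "norm u > 0" "norm v > 0" "norm w > 0"
    using False by (auto simp: outer_eq_0_iff)
  have "(norm (outer u v' w'))\<^sup>2 = (norm (outer u v w))\<^sup>2"
    using norm_A6_orthogonal[OF *(2)] assms by (simp add: *(1))
  then have "(norm u * norm v' * norm w')\<^sup>2 = (norm u * norm v * norm w)\<^sup>2"
    by (simp only: norm_outer_squared power_mult_distrib)
  then have eq: "norm v' * norm w' = norm v * norm w"
    using pos by (simp add: power2_eq_iff_nonneg)
  have "norm v' = norm v"
  proof (rule ccontr)
    assume "norm v' \<noteq> norm v"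
    then have "norm v' * norm w < norm v * norm w"
      using v pos by simp
    then have "norm v' * norm w' < norm v * norm w"
      using mult_left_mono[OF w(1), of "norm v'"] by simp
    with eq show False by simp
  qed
  moreover from this have "norm w' = norm w"
    using eq pos by simp
  ultimately show thesis
    using *(2) v w that by simp
qed

section \<open>The \<open>A6\<close> problem and the rank-1 problem\<close>

lemma norm_diff_squared:
  fixes a b :: "'a::real_inner"
  shows "(norm (a - b))\<^sup>2 = (norm a)\<^sup>2 - 2 * (a \<bullet> b) + (norm b)\<^sup>2"
  by (simp add: power2_norm_eq_inner inner_simps inner_commute)

text \<open>The two factors 6 give both expansions the same linear term, -12 times
  \<open>A \<bullet> outer u v w\<close>, by \<open>inner_A6\<close>. Only the quadratic terms
  survive.\<close>

lemma norm_diff_A6_vs_outer: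
  assumes "antisymmetric A"
  shows "(norm (A - 6 *\<^sub>R A6 u v w))\<^sup>2 - (norm A)\<^sup>2 - 6 * ((norm (A - outer u v w))\<^sup>2 - (norm A)\<^sup>2)
    = 6 * (6 * (norm (A6 u v w))\<^sup>2 - (norm (outer u v w))\<^sup>2)"
  unfolding norm_diff_squared using inner_A6[OF assms, of u v w]
  by (simp add: power_mult_distrib)

lemma norm_diff_A6_le_outer:
  assumes "antisymmetric A"
  shows "(norm (A - 6 *\<^sub>R A6 u v w))\<^sup>2 - (norm A)\<^sup>2 \<le> 6 * ((norm (A - outer u v w))\<^sup>2 - (norm A)\<^sup>2)"
  using norm_diff_A6_vs_outer[OF assms, of u v w] norm_A6_le_outer[of u v w] by argo

lemma norm_diff_A6_orthogonal:
  assumes "antisymmetric A" "pairwise_orthogonal3 u v w"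
  shows "(norm (A - 6 *\<^sub>R A6 u v w))\<^sup>2 - (norm A)\<^sup>2 = 6 * ((norm (A - outer u v w))\<^sup>2 - (norm A)\<^sup>2)"
  using norm_diff_A6_vs_outer[OF assms(1), of u v w] norm_A6_orthogonal[OF assms(2)] by argo

lemma A6_eq_6_orthogonal:
  obtains u v w where "A6 x y z = 6 *\<^sub>R A6 u v w" "pairwise_orthogonal3 u v w"
proof -
  \<comment> \<open>Scaling the first vector by 1/6 beforehand makes room for the factor 6.\<close>
  obtain v w where *: "A6 ((1/6) *\<^sub>R x) v w = A6 ((1/6) *\<^sub>R x) y z"
    "pairwise_orthogonal3 ((1/6) *\<^sub>R x) v w"
    using A6_orthogonalize .
  then show thesis
    by (intro that[OF _ *(2)]) (simp add: A6_scaleR)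
qed

lemma best_A6_iff:
  "best_A6 A x y z \<longleftrightarrow> (\<forall>x' y' z'. (norm (A - A6 x y z))\<^sup>2 \<le> (norm (A - A6 x' y' z'))\<^sup>2)"
  by (auto simp: best_A6_def is_arg_min_linorder)

lemma best_rank1_iff:
  "best_rank1 A u v w \<longleftrightarrow> (\<forall>u' v' w'. (norm (A - outer u v w))\<^sup>2 \<le> (norm (A - outer u' v' w'))\<^sup>2)"
  by (auto simp: best_rank1_def is_arg_min_linorder)

text \<open>The competitor enters through the inequality between the errors, the solution through
  its equality case for orthogonal triples.\<close>

lemma best_rank1_if_best_A6:
  fixes A :: "real^'n^'n^'n"
  assumes "antisymmetric A" "best_A6 A x y z" "A6 x y z = 6 *\<^sub>R A6 u v w"
    "pairwise_orthogonal3 u v w"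
  shows "best_rank1 A u v w"
  unfolding best_rank1_iff
proof (intro allI)
  fix u' v' w' :: "real^'n"
  have "(norm (A - A6 x y z))\<^sup>2 \<le> (norm (A - A6 (6 *\<^sub>R u') v' w'))\<^sup>2"
    using assms(2) unfolding best_A6_iff by blast
  then show "(norm (A - outer u v w))\<^sup>2 \<le> (norm (A - outer u' v' w'))\<^sup>2"
    using norm_diff_A6_le_outer[OF assms(1), of u' v' w'] norm_diff_A6_orthogonal[OF assms(1,4)]
    unfolding A6_scaleR assms(3) by argo
qed

text \<open>The roles are reversed: now the competitor is rewritten with an orthogonal triple to
  obtain equality, and the solution enters through the inequality.\<close>

lemma best_A6_if_best_rank1:
  fixes A :: "real^'n^'n^'n"
  assumes "antisymmetric A" "best_rank1 A u v w" "A6 x y z = 6 *\<^sub>R A6 u v w"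
  shows "best_A6 A x y z"
  unfolding best_A6_iff
proof (intro allI)
  fix x' y' z' :: "real^'n"
  obtain u' v' w' where *: "A6 x' y' z' = 6 *\<^sub>R A6 u' v' w'" "pairwise_orthogonal3 u' v' w'"
    using A6_eq_6_orthogonal .
  have "(norm (A - outer u v w))\<^sup>2 \<le> (norm (A - outer u' v' w'))\<^sup>2"
    using assms(2) unfolding best_rank1_iff by blast
  then show "(norm (A - A6 x y z))\<^sup>2 \<le> (norm (A - A6 x' y' z'))\<^sup>2"
    using norm_diff_A6_le_outer[OF assms(1), of u v w] norm_diff_A6_orthogonal[OF assms(1) *(2)]
    unfolding assms(3) *(1) by argo
qed

lemma best_A6_iff_best_rank1:
  assumes "antisymmetric A"
  shows "best_A6 A x y z \<longleftrightarrow> (\<exists>u v w. best_rank1 A u v w \<and> A6 x y z = 6 *\<^sub>R A6 u v w)"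
  using best_rank1_if_best_A6[OF assms] best_A6_if_best_rank1[OF assms] A6_eq_6_orthogonal[of x y z]
  by metis

text \<open>If \<open>norm_A6_le_outer\<close> were strict at a minimizer, an orthogonal triple with
  the same \<open>A6\<close> would have a smaller rank-1 error. So the equality case
  applies.\<close>

lemma best_rank1_iff_best_A6:
  assumes "antisymmetric A"
  shows "best_rank1 A u v w \<longleftrightarrow>
    (\<exists>u' v' w'. outer u v w = outer u' v' w' \<and> pairwise_orthogonal3 u' v' w' \<and>
       best_A6 A (6 *\<^sub>R u') v' w')"
proof
  assume best: "best_rank1 A u v w"
  obtain a b c where *: "6 *\<^sub>R A6 u v w = 6 *\<^sub>R A6 a b c" "pairwise_orthogonal3 a b c"
    using A6_eq_6_orthogonal[of "6 *\<^sub>R u" v w] by (auto simp: A6_scaleR)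
  have "(norm (A - outer u v w))\<^sup>2 \<le> (norm (A - outer a b c))\<^sup>2"
    using best unfolding best_rank1_iff by blast
  then have "6 * (norm (A6 u v w))\<^sup>2 = (norm (outer u v w))\<^sup>2"
    using norm_diff_A6_orthogonal[OF assms *(2)] norm_diff_A6_vs_outer[OF assms, of u v w]
      norm_A6_le_outer[of u v w] unfolding *(1) by argo
  then obtain u' v' w' where **: "outer u v w = outer u' v' w'" "pairwise_orthogonal3 u' v' w'"
    using outer_orthogonal_if_norm_eq by blast
  moreover from best have "best_A6 A (6 *\<^sub>R u') v' w'"
    by (intro best_A6_if_best_rank1[OF assms, of u' v' w']) (simp_all add: best_rank1_iff **(1) A6_scaleR)
  ultimately show "\<exists>u' v' w'. outer u v w = outer u' v' w' \<and> pairwise_orthogonal3 u' v' w' \<and>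
       best_A6 A (6 *\<^sub>R u') v' w'"
    by blast
next
  assume "\<exists>u' v' w'. outer u v w = outer u' v' w' \<and> pairwise_orthogonal3 u' v' w' \<and>
       best_A6 A (6 *\<^sub>R u') v' w'"
  then obtain u' v' w' where "outer u v w = outer u' v' w'" "pairwise_orthogonal3 u' v' w'"
       "best_A6 A (6 *\<^sub>R u') v' w'" by blast
  then show "best_rank1 A u v w"
    using best_rank1_if_best_A6[OF assms, of "6 *\<^sub>R u'" v' w' u' v' w']
    by (simp add: best_rank1_iff A6_scaleR)
qed

text \<open>Bridges objectives stated with the norm and objectives stated with its square.\<close>

lemma INF_power2:
  fixes f :: "'a \<Rightarrow> real"
  assumes "\<And>x. x \<in> S \<Longrightarrow> 0 \<le> f x" "S \<noteq> {}"
  shows "(INF x\<in>S. f x)\<^sup>2 = (INF x\<in>S. (f x)\<^sup>2)"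
proof (rule antisym)
  have bdd: "bdd_below (f ` S)" "bdd_below ((\<lambda>x. (f x)\<^sup>2) ` S)"
    using assms(1) by (auto intro!: bdd_belowI[of _ 0])
  have nonneg: "0 \<le> (INF x\<in>S. f x)"
    using assms by (intro cINF_greatest)
  show "(INF x\<in>S. f x)\<^sup>2 \<le> (INF x\<in>S. (f x)\<^sup>2)"
    using assms nonneg bdd by (intro cINF_greatest power_mono cINF_lower)
  have "sqrt (INF x\<in>S. (f x)\<^sup>2) \<le> (INF x\<in>S. f x)"
    using assms bdd by (intro cINF_greatest real_le_lsqrt cINF_lower)
  then show "(INF x\<in>S. (f x)\<^sup>2) \<le> (INF x\<in>S. f x)\<^sup>2"
    by (rule sqrt_le_D)
qed

text \<open>Each bound compares an arbitrary point of one problem with the infimum of the other: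
  orthogonal triples give one direction, the triple \<open>6 *\<^sub>R u\<close>, \<open>v\<close>,
  \<open>w\<close> the other.\<close>

lemma INF_A6_eq_INF_rank1:
  fixes A :: "real^'n^'n^'n"
  assumes "antisymmetric A"
  shows "(norm A)\<^sup>2 - (INF (x, y, z)\<in>UNIV. (norm (A - A6 x y z))\<^sup>2) =
    6 * ((norm A)\<^sup>2 - (INF (u, v, w)\<in>UNIV. norm (A - outer u v w))\<^sup>2)"
proof -
  define I where "I = (INF t. case t of (x, y, z) \<Rightarrow> (norm (A - A6 x y z))\<^sup>2)"
  define J where "J = (INF t. case t of (u, v, w) \<Rightarrow> (norm (A - outer u v w))\<^sup>2)"
  have "(INF (u, v, w)\<in>UNIV. norm (A - outer u v w))\<^sup>2 = J"
    unfolding J_def by (subst INF_power2) (auto simp: case_prod_unfold)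
  moreover have I: "I \<le> (norm (A - A6 x y z))\<^sup>2" for x y z
    unfolding I_def by (rule cINF_lower2[of _ _ "(x, y, z)"]) (auto intro!: bdd_belowI[of _ 0])
  have J: "J \<le> (norm (A - outer x y z))\<^sup>2" for x y z
    unfolding J_def by (rule cINF_lower2[of _ _ "(x, y, z)"]) (auto intro!: bdd_belowI[of _ 0])
  have "(norm A)\<^sup>2 - 6 * ((norm A)\<^sup>2 - J) \<le> I"
    unfolding I_def
  proof (rule cINF_greatest, simp, clarify)
    fix x y z :: "real^'n"
    obtain u v w where *: "A6 x y z = 6 *\<^sub>R A6 u v w" "pairwise_orthogonal3 u v w"
      using A6_eq_6_orthogonal .
    show "(norm A)\<^sup>2 - 6 * ((norm A)\<^sup>2 - J) \<le> (norm (A - A6 x y z))\<^sup>2"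
      using norm_diff_A6_orthogonal[OF assms *(2)] J[of u v w] unfolding *(1) by argo
  qed
  moreover have "(norm A)\<^sup>2 - ((norm A)\<^sup>2 - I) / 6 \<le> J"
    unfolding J_def
  proof (rule cINF_greatest, simp, clarify)
    fix u v w :: "real^'n"
    show "(norm A)\<^sup>2 - ((norm A)\<^sup>2 - I) / 6 \<le> (norm (A - outer u v w))\<^sup>2"
      using norm_diff_A6_le_outer[OF assms, of u v w] I[of "6 *\<^sub>R u" v w]
      unfolding A6_scaleR by argo
  qed
  ultimately show ?thesis
    unfolding I_def[symmetric] by argo
qed

section \<open>Multilinear products with orthonormal columns\<close>

lemma multi_prod_nth:
  "multi_prod S M $ i $ j $ k =
    (\<Sum>p\<in>UNIV. \<Sum>q\<in>UNIV. \<Sum>r\<in>UNIV. S $ p $ q $ r * M $ i $ p * M $ j $ q * M $ k $ r)"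
  using multi_prod_transpose_nth[of S "transpose M" i j k]
  by (simp only: transpose_transpose) (simp add: transpose_def)

lemma multi_prod_transpose_eq_inner:
  "multi_prod A (transpose V) $ p $ q $ r = A \<bullet> outer (column p V) (column q V) (column r V)"
  by (simp add: multi_prod_transpose_nth inner_outer_eq_sum column_def mult.assoc)

lemma multi_prod_eq_sum_outer:
  "multi_prod S V = (\<Sum>p\<in>UNIV. \<Sum>q\<in>UNIV. \<Sum>r\<in>UNIV.
     S $ p $ q $ r *\<^sub>R outer (column p V) (column q V) (column r V))"
  by (simp add: vec_eq_iff multi_prod_nth outer_def column_def mult.assoc)

text \<open>Expansion by \<open>V\<close> and compression by its transpose are adjoint: both sides
  pair the entries of \<open>S\<close> with the inner products of \<open>A\<close> and outer
  products of columns.\<close>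

lemma inner_multi_prod:
  fixes A :: "real^'n^'n^'n" and S :: "real^'p^'p^'p"
  shows "A \<bullet> multi_prod S V = S \<bullet> multi_prod A (transpose V)"
proof -
  have "A \<bullet> multi_prod S V = (\<Sum>p\<in>UNIV. \<Sum>q\<in>UNIV. \<Sum>r\<in>UNIV.
      S $ p $ q $ r * multi_prod A (transpose V) $ p $ q $ r)"
    unfolding multi_prod_transpose_eq_inner
    by (simp add: multi_prod_eq_sum_outer inner_sum_right)
  then show ?thesis
    by (simp add: inner_vec_def)
qed

lemma inner_column_orthonormal:
  assumes "orthonormal_columns V"
  shows "column p V \<bullet> column q V = of_bool (p = q)"
proof -
  have "(transpose V ** V) $ p $ q = mat 1 $ p $ q"
    using assms by (simp add: orthonormal_columns_def)
  then show ?thesis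
    by (simp add: matrix_matrix_mult_def transpose_def mat_def column_def inner_vec_def)
qed

lemma multi_prod_transpose_multi_prod:
  fixes V :: "real^'a^'b"
  assumes "orthonormal_columns V"
  shows "multi_prod (multi_prod S V) (transpose V) = S"
proof -
  have delta: "(\<Sum>i\<in>UNIV. f i * of_bool (i = j)) = f j" for f :: "'a \<Rightarrow> real" and j
  proof -
    have "(\<Sum>i\<in>UNIV. f i * of_bool (i = j)) = (\<Sum>i\<in>UNIV. if i = j then f i else 0)"
      by (intro sum.cong) auto
    then show ?thesis
      by simp
  qed
  have "multi_prod (multi_prod S V) (transpose V) $ p $ q $ r = S $ p $ q $ r" for p q r
  proof -
    have "multi_prod (multi_prod S V) (transpose V) $ p $ q $ r =
      (\<Sum>p'\<in>UNIV. \<Sum>q'\<in>UNIV. \<Sum>r'\<in>UNIV. S $ p' $ q' $ r' *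
        (of_bool (p' = p) * of_bool (q' = q) * of_bool (r' = r)))"
      unfolding multi_prod_transpose_eq_inner multi_prod_eq_sum_outer[of S V]
      by (simp only: inner_sum_left inner_scaleR_left inner_outer_outer
          inner_column_orthonormal[OF assms])
    also have "\<dots> = S $ p $ q $ r"
      \<comment> \<open>Associating to the left exposes the indicator of the innermost summation
        index, so the sums collapse from the inside out.\<close>
      by (simp only: delta flip: mult.assoc)
    finally show ?thesis .
  qed
  then show ?thesis
    by (simp add: vec_eq_iff)
qed

lemma norm_multi_prod_squared:
  assumes "orthonormal_columns V"
  shows "(norm (multi_prod S V))\<^sup>2 = (norm S)\<^sup>2"
  using inner_multi_prod[of "multi_prod S V" S V] multi_prod_transpose_multi_prod[OF assms, of S]
  by (simp add: power2_norm_eq_inner)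

text \<open>Completing the square: expansion is an isometry, and its adjoint is compression.\<close>

lemma norm_diff_multi_prod:
  assumes "orthonormal_columns V"
  shows "(norm (A - multi_prod S V))\<^sup>2 = (norm A)\<^sup>2 - (norm (multi_prod A (transpose V)))\<^sup>2
    + (norm (S - multi_prod A (transpose V)))\<^sup>2"
  unfolding norm_diff_squared norm_multi_prod_squared[OF assms] inner_multi_prod[of A S V] by simp

lemma antisymmetric_multi_prod_transpose:
  assumes "antisymmetric A"
  shows "antisymmetric (multi_prod A (transpose V))"
proof -
  have swap: "A \<bullet> outer v u w = - (A \<bullet> outer u v w)" "A \<bullet> outer u w v = - (A \<bullet> outer u v w)" for u v w
    using inner_outer_swap12[OF assms] inner_outer_swap23[OF assms] by blast+
  have "A \<bullet> outer v w u = A \<bullet> outer u v w" "A \<bullet> outer w u v = A \<bullet> outer u v w"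
    "A \<bullet> outer w v u = - (A \<bullet> outer u v w)" for u v w
    using swap(1)[of v u w] swap(2)[of u v w] swap(1)[of u w v] swap(2)[of v u w] swap(1)[of v w u]
    by simp_all
  then show ?thesis
    unfolding antisymmetric_def multi_prod_transpose_eq_inner using swap by (metis minus_minus)
qed

section \<open>Antisymmetric 3x3x3 cores and \<open>A6\<close>\<close>

lemma multi_prod_antisymmetric_eq_A6:
  fixes S :: "real^3^3^3"
  assumes "antisymmetric S"
  shows "multi_prod S V = A6 ((6 * S $ 1 $ 2 $ 3) *\<^sub>R column 1 V) (column 2 V) (column 3 V)"
proof -
  have S: "S $ i $ j $ k = - S $ i $ k $ j" "S $ i $ j $ k = - S $ j $ i $ k"
      "S $ i $ j $ k = - S $ k $ j $ i" for i j k
    using assms unfolding antisymmetric_def by blast+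
  \<comment> \<open>Only the six permutations of 1, 2, 3 survive, each with entry
    \<open>S $ 1 $ 2 $ 3\<close> up to sign. This is the sum defining \<open>A6\<close>, and the
    factor 6 undoes its 1/6.\<close>
  have 0: "S $ i $ j $ j = 0" "S $ i $ i $ j = 0" "S $ i $ j $ i = 0" for i j
    using S(1)[of i j j] S(2)[of i i j] S(3)[of i j i] by simp_all
  have e: "S $ 1 $ 3 $ 2 = - S $ 1 $ 2 $ 3" "S $ 2 $ 1 $ 3 = - S $ 1 $ 2 $ 3"
     "S $ 3 $ 2 $ 1 = - S $ 1 $ 2 $ 3"
    by (fact S)+
  have e': "S $ 2 $ 3 $ 1 = S $ 1 $ 2 $ 3" "S $ 3 $ 1 $ 2 = S $ 1 $ 2 $ 3"
    using S(1)[of 2 3 1] S(1)[of 3 1 2] e by simp_all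
  show ?thesis
    unfolding multi_prod_eq_sum_outer sum_3 0 e e' A6_scaleR
    by (simp add: A6_def algebra_simps)
qed

lemma multi_prod_outer: "multi_prod (outer a b c) V = outer (V *v a) (V *v b) (V *v c)"
proof -
  have "multi_prod (outer a b c) V $ i $ j $ k = outer (V *v a) (V *v b) (V *v c) $ i $ j $ k" for i j k
  proof -
    have "multi_prod (outer a b c) V $ i $ j $ k = (\<Sum>p\<in>UNIV. \<Sum>q\<in>UNIV. \<Sum>r\<in>UNIV.
        (V $ i $ p * a $ p) * ((V $ j $ q * b $ q) * (V $ k $ r * c $ r)))"
      unfolding multi_prod_nth outer_def by (simp add: ac_simps)
    then show ?thesis
      by (simp add: outer_def matrix_vector_mult_def flip: sum_distrib_left sum_distrib_right)
  qed
  then show ?thesis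
    by (simp add: vec_eq_iff)
qed

lemma linear_multi_prod: "linear (\<lambda>S. multi_prod S V)"
  by (rule linearI) (simp_all add: multi_prod_eq_sum_outer scaleR_add_left sum.distrib scaleR_sum_right)

lemma multi_prod_A6: "multi_prod (A6 a b c) V = A6 (V *v a) (V *v b) (V *v c)"
  unfolding A6_def
  by (simp add: linear_add[OF linear_multi_prod] linear_diff[OF linear_multi_prod]
      linear_scale[OF linear_multi_prod] multi_prod_outer)

text \<open>The identity of size 3 has rank 3 and factors through \<open>V\<close>. This supplies
  the dimension guard whenever a feasible \<open>V\<close> is given.\<close>

lemma CARD_ge_3_if_orthonormal_columns:
  fixes V :: "real^3^'n"
  assumes "orthonormal_columns V"
  shows "3 \<le> CARD('n)"
proof -
  have "rank (transpose V ** V) \<le> rank V"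
    by (rule rank_mul_le_right)
  then show ?thesis
    using assms rank_bound[of V] by (simp add: orthonormal_columns_def rank_I)
qed

lemma orthonormal_columns_span:
  fixes x y z :: "real^'n"
  assumes "3 \<le> CARD('n)"
  obtains V :: "real^3^'n" and a b c
  where "orthonormal_columns V" "x = V *v a" "y = V *v b" "z = V *v c"
proof -
  obtain C where C: "C \<subseteq> {x, y, z}" "independent C" "{x, y, z} \<subseteq> span C"
    by (rule maximal_independent_subset)
  obtain D where D: "C \<subseteq> D" "independent D" "UNIV \<subseteq> span D"
    by (rule maximal_independent_subset_extend[OF subset_UNIV C(2)])
  have "finite D" "card D = CARD('n)"
    using D basis_card_eq_dim[of D UNIV] by (auto simp: finiteI_independent)
  moreover have "card C \<le> 3"
    using card_mono[OF _ C(1)] card_insert_le_m1 by (simp add: card_insert_if split: if_splits)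
  \<comment> \<open>The vectors may be dependent, so their basis \<open>C\<close> is padded inside a
    basis of the whole space to exactly three elements.\<close>
  ultimately obtain E where E: "C \<subseteq> E" "E \<subseteq> D" "card E = 3"
    using exists_subset_between[of C 3 D] assms D(1) by auto
  have "dim (span E) = 3"
    using E(3) independent_mono[OF D(2) E(2)] dim_span_eq_card_independent[of E] by simp
  then obtain B where B: "pairwise orthogonal B" "\<And>v. v \<in> B \<Longrightarrow> norm v = 1"
      "card B = 3" "span B = span E"
    using orthonormal_basis_subspace[of "span E"] subspace_span by metis
  obtain b1 b2 b3 where b: "B = {b1, b2, b3}" "b1 \<noteq> b2" "b1 \<noteq> b3" "b2 \<noteq> b3"
    using B(3) unfolding card_3_iff by metis
  define V :: "real^3^'n" where "V = (\<chi> i j. (vector [b1, b2, b3] :: (real^'n)^3) $ j $ i)"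
  have col: "column 1 V = b1" "column 2 V = b2" "column 3 V = b3"
    by (simp_all add: V_def column_def vec_eq_iff)
  have "(transpose V ** V) $ p $ q = column p V \<bullet> column q V" for p q
    by (simp add: matrix_matrix_mult_def transpose_def column_def inner_vec_def)
  moreover have "b1 \<bullet> b1 = 1" "b2 \<bullet> b2 = 1" "b3 \<bullet> b3 = 1"
    using B(2) by (simp_all add: b norm_eq_1)
  moreover have "b1 \<bullet> b2 = 0" "b1 \<bullet> b3 = 0" "b2 \<bullet> b3 = 0" "b2 \<bullet> b1 = 0" "b3 \<bullet> b1 = 0" "b3 \<bullet> b2 = 0"
    using B(1) b by (auto simp: pairwise_def orthogonal_def)
  ultimately have "orthonormal_columns V"
    by (simp add: orthonormal_columns_def vec_eq_iff forall_3 mat_def col)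
  moreover have "\<exists>a. v = V *v a" if v: "v \<in> {x, y, z}" for v
  proof -
    have "v \<in> span B"
      using v C(3) span_mono[OF E(1)] B(4) by auto
    then obtain k1 k2 k3 where "v = k1 *\<^sub>R b1 + k2 *\<^sub>R b2 + k3 *\<^sub>R b3"
      unfolding b(1) span_breakdown_eq by (auto simp: algebra_simps)
    then have "v = V *v vector [k1, k2, k3]"
      by (simp add: matrix_mult_sum sum_3 col scalar_mult_eq_scaleR)
    then show ?thesis ..
  qed
  ultimately show thesis
    using that by (metis insertCI)
qed

text \<open>The core is \<open>A6\<close> of the coordinates of \<open>x\<close>, \<open>y\<close>,
  \<open>z\<close> in an orthonormal frame whose span contains them.\<close>

lemma A6_eq_multi_prod:
  fixes x y z :: "real^'n"
  assumes "3 \<le> CARD('n)"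
  obtains S :: "real^3^3^3" and V :: "real^3^'n"
  where "antisymmetric S" "orthonormal_columns V" "A6 x y z = multi_prod S V"
  using orthonormal_columns_span[OF assms, of x y z] multi_prod_A6 antisymmetric_A6 by metis

section \<open>The structured problem and the maximization over \<open>V\<close>\<close>

lemma best_structured_iff:
  fixes A :: "real^'n^'n^'n"
  shows
  "best_structured A S V \<longleftrightarrow> antisymmetric S \<and> orthonormal_columns V \<and>
    (\<forall>(S' :: real^3^3^3) V'. antisymmetric S' \<and> orthonormal_columns V' \<longrightarrow>
      (norm (A - multi_prod S V))\<^sup>2 \<le> (norm (A - multi_prod S' V'))\<^sup>2)"
  by (auto simp: best_structured_def is_arg_min_linorder)

lemma max_compression_iff:
  fixes A :: "real^'n^'n^'n"
  shows
  "max_compression A V \<longleftrightarrow> orthonormal_columns V \<and>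
    (\<forall>V' :: real^3^'n. orthonormal_columns V' \<longrightarrow>
      (norm (multi_prod A (transpose V')))\<^sup>2 \<le> (norm (multi_prod A (transpose V)))\<^sup>2)"
  by (auto simp: max_compression_def is_arg_max_linorder)

text \<open>Both problems range over the same set of approximating tensors, and optimality depends
  on the tensor alone.\<close>

lemma best_A6_iff_best_structured:
  fixes A :: "real^'n^'n^'n"
  assumes "3 \<le> CARD('n)"
  shows "best_A6 A x y z \<longleftrightarrow> (\<exists>S V. best_structured A S V \<and> A6 x y z = multi_prod S V)"
proof
  assume best: "best_A6 A x y z"
  obtain S and V :: "real^3^'n" where *: "antisymmetric S" "orthonormal_columns V" "A6 x y z = multi_prod S V"
    using A6_eq_multi_prod[OF assms] .
  moreover have "best_structured A S V"
    using best * unfolding best_structured_iff best_A6_iff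
    by (metis multi_prod_antisymmetric_eq_A6)
  ultimately show "\<exists>S V. best_structured A S V \<and> A6 x y z = multi_prod S V"
    by blast
next
  assume "\<exists>S V. best_structured A S V \<and> A6 x y z = multi_prod S V"
  then show "best_A6 A x y z"
    unfolding best_structured_iff best_A6_iff using A6_eq_multi_prod[OF assms] by metis
qed

lemma best_structured_iff_best_A6:
  fixes A :: "real^'n^'n^'n"
  shows "best_structured A S V \<longleftrightarrow> antisymmetric S \<and> orthonormal_columns V \<and>
    (\<exists>x y z. best_A6 A x y z \<and> multi_prod S V = A6 x y z)"
proof
  assume best: "best_structured A S V"
  then have SV: "antisymmetric S" "orthonormal_columns V"
    by (auto simp: best_structured_iff)
  moreover have "best_A6 A ((6 * S $ 1 $ 2 $ 3) *\<^sub>R column 1 V) (column 2 V) (column 3 V)"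
    unfolding best_A6_iff_best_structured[OF CARD_ge_3_if_orthonormal_columns[OF SV(2)]]
    using best multi_prod_antisymmetric_eq_A6[OF SV(1), symmetric] by blast
  ultimately show "antisymmetric S \<and> orthonormal_columns V \<and>
      (\<exists>x y z. best_A6 A x y z \<and> multi_prod S V = A6 x y z)"
    using multi_prod_antisymmetric_eq_A6[OF SV(1)] by blast
next
  assume "antisymmetric S \<and> orthonormal_columns V \<and>
      (\<exists>x y z. best_A6 A x y z \<and> multi_prod S V = A6 x y z)"
  then show "best_structured A S V"
    unfolding best_structured_iff best_A6_iff by (metis multi_prod_antisymmetric_eq_A6)
qed

lemma best_structured_iff_max_compression:
  fixes A :: "real^'n^'n^'n"
  assumes "antisymmetric A"
  shows "best_structured A S V \<longleftrightarrow> max_compression A V \<and> S = multi_prod A (transpose V)"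
proof
  let ?P = "\<lambda>V. multi_prod A (transpose V)"
  assume best: "best_structured A S V"
  then have V: "orthonormal_columns V"
    by (simp add: best_structured_iff)
  have le: "(norm (?P V'))\<^sup>2 + (norm (S - ?P V))\<^sup>2 \<le> (norm (?P V))\<^sup>2"
    if V': "orthonormal_columns V'" for V' :: "real^3^'n"
  proof -
    \<comment> \<open>The competitor pairs \<open>V'\<close> with its own best core, the compression
      of \<open>A\<close>.\<close>
    have "(norm (A - multi_prod S V))\<^sup>2 \<le> (norm (A - multi_prod (?P V') V'))\<^sup>2"
      using best antisymmetric_multi_prod_transpose[OF assms, of V'] V'
      unfolding best_structured_iff by blast
    then show ?thesis
      unfolding norm_diff_multi_prod[OF V, of A S] norm_diff_multi_prod[OF V', of A "?P V'"]
      by simp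
  qed
  \<comment> \<open>For \<open>V' = V\<close> the compression norms cancel, so the remaining square
    is zero.\<close>
  from le[OF V] have S: "S = ?P V"
    by simp
  have "(norm (?P V'))\<^sup>2 \<le> (norm (?P V))\<^sup>2" if "orthonormal_columns V'" for V' :: "real^3^'n"
    using le[OF that] zero_le_power2[of "norm (S - ?P V)"] by linarith
  with V S show "max_compression A V \<and> S = ?P V"
    unfolding max_compression_iff by blast
next
  let ?P = "\<lambda>V. multi_prod A (transpose V)"
  assume "max_compression A V \<and> S = ?P V"
  then have S: "S = ?P V" and V: "orthonormal_columns V"
    and max: "\<forall>V' :: real^3^'n. orthonormal_columns V' \<longrightarrow> (norm (?P V'))\<^sup>2 \<le> (norm (?P V))\<^sup>2"
    unfolding max_compression_iff by blast+
  have "(norm (A - multi_prod S V))\<^sup>2 \<le> (norm (A - multi_prod S' V'))\<^sup>2"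
    if V': "orthonormal_columns V'" for S' and V' :: "real^3^'n"
    using max[rule_format, OF V'] zero_le_power2[of "norm (S' - ?P V')"]
    unfolding S norm_diff_multi_prod[OF V, of A "?P V"] norm_diff_multi_prod[OF V', of A S']
      diff_self norm_zero zero_power2
    by linarith
  moreover have "antisymmetric S"
    unfolding S by (rule antisymmetric_multi_prod_transpose[OF assms])
  ultimately show "best_structured A S V"
    using V unfolding best_structured_iff by blast
qed

lemma best_A6_iff_max_compression:
  fixes A :: "real^'n^'n^'n"
  assumes "antisymmetric A" "3 \<le> CARD('n)"
  shows "best_A6 A x y z \<longleftrightarrow>
    (\<exists>V. max_compression A V \<and> A6 x y z = multi_prod (multi_prod A (transpose V)) V)"
  unfolding best_A6_iff_best_structured[OF assms(2)]
    best_structured_iff_max_compression[OF assms(1)] by blast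

lemma INF_A6_eq_INF_structured:
  fixes A :: "real^'n^'n^'n"
  assumes "3 \<le> CARD('n)"
  shows "(INF (x, y, z)\<in>UNIV. (norm (A - A6 x y z))\<^sup>2) =
    (INF (S, V)\<in>{(S :: real^3^3^3, V :: real^3^'n). antisymmetric S \<and> orthonormal_columns V}.
      norm (A - multi_prod S V))\<^sup>2"
proof -
  let ?X = "{(S :: real^3^3^3, V :: real^3^'n). antisymmetric S \<and> orthonormal_columns V}"
  let ?f = "\<lambda>(x, y, z). (norm (A - A6 x y z))\<^sup>2" and ?g = "\<lambda>(S, V). norm (A - multi_prod S V)"
  have "range ?f = (\<lambda>p. (?g p)\<^sup>2) ` ?X"
  proof (intro subset_antisym image_subsetI)
    fix t :: "(real^'n) \<times> (real^'n) \<times> (real^'n)"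
    obtain x y z where t: "t = (x, y, z)"
      by (cases t)
    obtain S :: "real^3^3^3" and V :: "real^3^'n"
      where *: "antisymmetric S" "orthonormal_columns V" "A6 x y z = multi_prod S V"
      using A6_eq_multi_prod[OF assms] .
    show "?f t \<in> (\<lambda>p. (?g p)\<^sup>2) ` ?X"
      by (rule image_eqI[of _ _ "(S, V)"]) (simp_all add: t *)
  next
    fix p :: "(real^3^3^3) \<times> (real^3^'n)"
    assume "p \<in> ?X"
    then obtain S V where p: "p = (S, V)" and S: "antisymmetric S"
      by auto
    show "(?g p)\<^sup>2 \<in> range ?f"
      by (rule image_eqI[of _ _ "((6 * S $ 1 $ 2 $ 3) *\<^sub>R column 1 V, column 2 V, column 3 V)"])
        (simp_all add: p multi_prod_antisymmetric_eq_A6[OF S, of V])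
  qed
  moreover have "?X \<noteq> {}"
    by (rule A6_eq_multi_prod[OF assms, of 0 0 0]) blast
  then have "(INF p\<in>?X. ?g p)\<^sup>2 = (INF p\<in>?X. (?g p)\<^sup>2)"
    by (intro INF_power2) auto
  ultimately show ?thesis
    by simp
qed

text \<open>By \<open>norm_diff_multi_prod\<close>, the compression is the best core for each
  \<open>V\<close>, with squared error \<open>(norm A)\<^sup>2\<close> minus its squared
  norm.\<close>

lemma INF_A6_eq_SUP_compression:
  fixes A :: "real^'n^'n^'n"
  assumes "antisymmetric A" "3 \<le> CARD('n)"
  shows "(INF (x, y, z)\<in>UNIV. (norm (A - A6 x y z))\<^sup>2) = (norm A)\<^sup>2 -
    (SUP V\<in>{V :: real^3^'n. orthonormal_columns V}. norm (multi_prod A (transpose V)))\<^sup>2"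
proof -
  let ?P = "\<lambda>V. multi_prod A (transpose V)" and ?X = "{V :: real^3^'n. orthonormal_columns V}"
  define I where "I = (INF t. case t of (x, y, z) \<Rightarrow> (norm (A - A6 x y z))\<^sup>2)"
  define s where "s = (SUP V\<in>?X. norm (?P V))"
  have ne: "?X \<noteq> {}"
    by (rule A6_eq_multi_prod[OF assms(2), of 0 0 0]) blast
  \<comment> \<open>Besides giving one of the two inequalities, this bounds the set whose supremum
    is \<open>s\<close>.\<close>
  have P_le: "norm (?P V) \<le> sqrt ((norm A)\<^sup>2 - I)" if V: "V \<in> ?X" for V
  proof (rule real_le_rsqrt)
    have "multi_prod (?P V) V = A6 ((6 * ?P V $ 1 $ 2 $ 3) *\<^sub>R column 1 V) (column 2 V) (column 3 V)"
      by (intro multi_prod_antisymmetric_eq_A6 antisymmetric_multi_prod_transpose assms(1))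
    then have "I \<le> (norm (A - multi_prod (?P V) V))\<^sup>2"
      unfolding I_def
      by (intro cINF_lower2[of _ _ "((6 * ?P V $ 1 $ 2 $ 3) *\<^sub>R column 1 V, column 2 V, column 3 V)"])
        (auto intro!: bdd_belowI[of _ 0])
    then show "(norm (?P V))\<^sup>2 \<le> (norm A)\<^sup>2 - I"
      using V by (simp add: norm_diff_multi_prod)
  qed
  have P_s: "norm (?P V) \<le> s" if "V \<in> ?X" for V
    unfolding s_def using that by (intro cSUP_upper bdd_aboveI2[OF P_le])
  have "s \<le> sqrt ((norm A)\<^sup>2 - I)"
    unfolding s_def using ne P_le by (rule cSUP_least)
  moreover obtain V where V: "V \<in> ?X"
    using ne by blast
  \<comment> \<open>Since \<open>sqrt\<close> is negative at negative reals, the second fact makes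
    the radicand nonnegative, and squaring recovers it.\<close>
  then have "0 \<le> s" "0 \<le> sqrt ((norm A)\<^sup>2 - I)"
    using P_s[OF V] P_le[OF V] norm_ge_zero[of "?P V"] by argo+
  ultimately have "s\<^sup>2 \<le> (norm A)\<^sup>2 - I"
    using power_mono[of s "sqrt ((norm A)\<^sup>2 - I)" 2] by simp
  moreover have "(norm A)\<^sup>2 - s\<^sup>2 \<le> I"
    unfolding I_def
  proof (rule cINF_greatest, simp, clarify)
    fix x y z :: "real^'n"
    obtain S and V :: "real^3^'n"
      where *: "antisymmetric S" "orthonormal_columns V" "A6 x y z = multi_prod S V"
      using A6_eq_multi_prod[OF assms(2)] .
    have "(norm (?P V))\<^sup>2 \<le> s\<^sup>2"
      using P_s[of V] *(2) by (intro power_mono) auto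
    then show "(norm A)\<^sup>2 - s\<^sup>2 \<le> (norm (A - A6 x y z))\<^sup>2"
      using norm_diff_multi_prod[OF *(2), of A S] zero_le_power2[of "norm (S - ?P V)"]
      unfolding *(3) by argo
  qed
  ultimately show ?thesis
    unfolding I_def s_def by argo
qed

text \<open>With the compression as core, \<open>V\<close> solves the structured problem exactly
  when it maximizes; \<open>multi_prod_antisymmetric_eq_A6\<close> then supplies the three vectors
  and the coefficient 6.\<close>

lemma max_compression_iff_best_A6:
  fixes A :: "real^'n^'n^'n"
  assumes "antisymmetric A"
  shows "max_compression A V \<longleftrightarrow> orthonormal_columns V \<and>
    best_A6 A ((6 * multi_prod A (transpose V) $ 1 $ 2 $ 3) *\<^sub>R column 1 V) (column 2 V) (column 3 V)"
proof -
  let ?P = "multi_prod A (transpose V)"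
  have P: "antisymmetric ?P"
    by (rule antisymmetric_multi_prod_transpose[OF assms])
  have "max_compression A V \<longleftrightarrow> best_structured A ?P V"
    using best_structured_iff_max_compression[OF assms] by blast
  also have "\<dots> \<longleftrightarrow> orthonormal_columns V \<and>
      best_A6 A ((6 * ?P $ 1 $ 2 $ 3) *\<^sub>R column 1 V) (column 2 V) (column 3 V)"
    unfolding best_structured_iff_best_A6 best_A6_iff multi_prod_antisymmetric_eq_A6[OF P, of V]
    using P by auto
  finally show ?thesis .
qed

(* Two problems are equivalent: solutions of each are translated explicitly into solutions of
   the other, and the optimal values determine each other. A matrix with three orthonormal
   columns exists only if it has at least three rows, whence the guards 3 \<le> CARD('n). *)
theorem mainTheorem1:
  fixes A :: "real^'n^'n^'n"
  assumes "antisymmetric A"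
  shows
    \<comment> \<open>approximation by \<open>A6\<close> and structured multilinear rank-3 approximation\<close>
    "(3 \<le> CARD('n) \<longrightarrow>
       (\<forall>x y z. best_A6 A x y z \<longleftrightarrow>
          (\<exists>S V. best_structured A S V \<and> A6 x y z = multi_prod S V))) \<and>
     (\<forall>S V. best_structured A S V \<longleftrightarrow>
        antisymmetric S \<and> orthonormal_columns V \<and>
        (\<exists>x y z. best_A6 A x y z \<and> multi_prod S V = A6 x y z)) \<and>
     (3 \<le> CARD('n) \<longrightarrow>
       (INF (x, y, z)\<in>UNIV. (norm (A - A6 x y z))\<^sup>2) =
       (INF (S, V)\<in>{(S :: real^3^3^3, V :: real^3^'n). antisymmetric S \<and> orthonormal_columns V}.
          norm (A - multi_prod S V))\<^sup>2) \<and>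
     \<comment> \<open>structured multilinear rank-3 approximation and maximization over \<open>V\<close>\<close>
     (\<forall>S V. best_structured A S V \<longleftrightarrow>
        max_compression A V \<and> S = multi_prod A (transpose V)) \<and>
     \<comment> \<open>approximation by \<open>A6\<close> and maximization over \<open>V\<close>\<close>
     (3 \<le> CARD('n) \<longrightarrow>
       (\<forall>x y z. best_A6 A x y z \<longleftrightarrow>
          (\<exists>V. max_compression A V \<and>
             A6 x y z = multi_prod (multi_prod A (transpose V)) V))) \<and>
     (\<forall>V. max_compression A V \<longleftrightarrow>
        orthonormal_columns V \<and>
        best_A6 A ((6 * multi_prod A (transpose V) $ 1 $ 2 $ 3) *\<^sub>R column 1 V)
          (column 2 V) (column 3 V)) \<and>
     (3 \<le> CARD('n) \<longrightarrow>
       (INF (x, y, z)\<in>UNIV. (norm (A - A6 x y z))\<^sup>2) =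
       (norm A)\<^sup>2 -
       (SUP V\<in>{V :: real^3^'n. orthonormal_columns V}. norm (multi_prod A (transpose V)))\<^sup>2) \<and>
     \<comment> \<open>approximation by \<open>A6\<close> and unstructured rank-1 approximation\<close>
     (\<forall>x y z. best_A6 A x y z \<longleftrightarrow>
        (\<exists>u v w. best_rank1 A u v w \<and> A6 x y z = 6 *\<^sub>R A6 u v w)) \<and>
     (\<forall>u v w. best_rank1 A u v w \<longleftrightarrow>
        (\<exists>u' v' w'. outer u v w = outer u' v' w' \<and> pairwise_orthogonal3 u' v' w' \<and>
           best_A6 A (6 *\<^sub>R u') v' w')) \<and>
     (norm A)\<^sup>2 - (INF (x, y, z)\<in>UNIV. (norm (A - A6 x y z))\<^sup>2) =
     6 * ((norm A)\<^sup>2 - (INF (u, v, w)\<in>UNIV. norm (A - outer u v w))\<^sup>2)"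
  by (intro conjI impI allI)
    (fact best_A6_iff_best_structured best_structured_iff_best_A6 INF_A6_eq_INF_structured
      best_structured_iff_max_compression[OF assms] best_A6_iff_max_compression[OF assms]
      max_compression_iff_best_A6[OF assms] INF_A6_eq_SUP_compression[OF assms]
      best_A6_iff_best_rank1[OF assms] best_rank1_iff_best_A6[OF assms]
      INF_A6_eq_INF_rank1[OF assms])+

end
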